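(* Let $n\ge4$. The maximum length of a coherent lattice path of size $n$ is $\ell_{\max}=\left\lfloor\tfrac32(n-1)\right\rfloor$. The number of coherent lattice paths of size $n$ and length $\ell_{\max}$ is $1$ if $n$ is odd and $\left\lfloor\tfrac32(n-1)\right\rfloor$ if $n$ is even.
   Context: A diagonal-avoiding lattice path of size $n$ (dimension 2) is a sequence of points $\boldsymbol\ell_1,\dots,\boldsymbol\ell_r\in[n]^2$ with $\boldsymbol\ell_1=(2,1)$, $\boldsymbol\ell_r\in\{(n-1,n),(n,n-1)\}$, the two coordinates of each point distinct, and consecutive points differing in exactly one coordinate, which strictly increases; its length is $r$ (the number of points). Its $i$-th enhanced step is $(a\to b;z)$ where the changing coordinate goes from $a$ to $b$ and the fixed coordinate equals $z$; $\prec$ denotes the order of steps along the path. It is a coherent lattice path if for all enhanced steps $(i\to j;a)\prec(x\to y;z)$ with $x<j$ one has $j=z$ or $x=a$. (These correspond bijectively, preserving length = number of vertices, to coherent monotone paths on the hypersimplex $\Delta(n,2)$ for a generic direction.) *)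

theory Defs
  imports Complex_Main
begin

definition lattice_step :: "nat \<times> nat \<Rightarrow> nat \<times> nat \<Rightarrow> bool" where
  "lattice_step p q \<longleftrightarrow>
     (fst p < fst q \<and> snd p = snd q) \<or> (fst p = fst q \<and> snd p < snd q)"

text \<open>
  A path is the list of its points, so its length, counted in points as usual here,
  is the length of the list.
\<close>

definition diagonal_avoiding_path :: "nat \<Rightarrow> (nat \<times> nat) list \<Rightarrow> bool" where
  "diagonal_avoiding_path n P \<longleftrightarrow>
     P \<noteq> [] \<and> set P \<subseteq> {1..n} \<times> {1..n} \<and>
     hd P = (2, 1) \<and> last P \<in> {(n - 1, n), (n, n - 1)} \<and>
     (\<forall>p \<in> set P. fst p \<noteq> snd p) \<and>
     successively lattice_step P"

text \<open>
  The triple \<open>(a, b, z)\<close> encodes the enhanced step \<open>(a \<rightarrow> b; z)\<close>: the changing coordinate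
  goes from \<open>a\<close> to \<open>b\<close>, the other one equals \<open>z\<close>. Which of the two coordinates changes is
  not recorded. Steps of a path are indexed from 0, in path order.
\<close>

definition enhanced_step :: "(nat \<times> nat) list \<Rightarrow> nat \<Rightarrow> nat \<times> nat \<times> nat" where
  "enhanced_step P k =
     (if snd (P ! k) = snd (P ! Suc k)
      then (fst (P ! k), fst (P ! Suc k), snd (P ! k))
      else (snd (P ! k), snd (P ! Suc k), fst (P ! k)))"

definition coherent_path :: "nat \<Rightarrow> (nat \<times> nat) list \<Rightarrow> bool" where
  "coherent_path n P \<longleftrightarrow>
     diagonal_avoiding_path n P \<and>
     (\<forall>k m i j a x y z.
        k < m \<and> Suc m < length P \<and>
        enhanced_step P k = (i, j, a) \<and> enhanced_step P m = (x, y, z) \<and> x < j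
        \<longrightarrow> j = z \<or> x = a)"

definition max_length :: "nat \<Rightarrow> nat" where
  "max_length n = Max (length ` {P. coherent_path n P})"

text \<open>The maximum is taken over a finite nonempty set, and the counts are of finite sets.\<close>

lemma finite_coherent_paths: "finite {P. coherent_path n P}"
proof (rule finite_subset)
  have "distinct P" if "successively lattice_step P" for P
  proof -
    have "successively (\<lambda>p q. fst p + snd p < fst q + snd q) P"
      using that by (rule successively_mono) (auto simp: lattice_step_def)
    then have "sorted_wrt (\<lambda>p q. fst p + snd p < fst q + snd q) P"
      by (subst (asm) successively_conv_sorted_wrt) (auto intro!: transpI)
    then show ?thesis
      by (induction P) auto
  qed
  then show "{P. coherent_path n P} \<subseteq> {P. set P \<subseteq> {1..n} \<times> {1..n} \<and> distinct P}"
    by (auto simp: coherent_path_def diagonal_avoiding_path_def)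
  show "finite {P. set P \<subseteq> {1..n} \<times> {1..n} \<and> distinct P}"
    by (rule finite_subset_distinct) simp
qed

lemma coherent_path_exists:
  assumes "n \<ge> 4"
  shows "coherent_path n [(2, 1), (n, 1), (n, n - 1)]"
  using assms
  by (auto simp: coherent_path_def diagonal_avoiding_path_def lattice_step_def
      enhanced_step_def less_Suc_eq)

end

theory Submission
  imports Defs
begin

text \<open>
  Let \<open>visits P w\<close> be the number of coordinates (0, 1 or 2) in which a coherent path \<open>P\<close> takes the
  value \<open>w\<close>; these numbers add up to \<open>length P + 1\<close>. Coherence forbids that both \<open>w\<close> and \<open>w + 1\<close>
  are taken by both coordinates, so consecutive values are visited at most three times, while 1 and \<open>n\<close>
  are visited once each. Summing over the pairs \<open>(2, 3), (4, 5), \<dots>\<close> gives the bound.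

  On a path of maximal length each of these pairs is visited exactly three times. Looking at the
  values 2 to 5 only, this determines the first four points up to four possibilities, and in each of
  them the path from the fourth point on is, after translation by 2 and possibly exchanging
  coordinates, a maximal path of size \<open>n - 2\<close>. In one case this path is arbitrary, in the other three
  it must start vertically. Since for even \<open>n\<close> there is exactly one maximal path that starts
  vertically and for odd \<open>n\<close> there is none, the number of maximal paths grows by 3 or 0 from \<open>n - 2\<close>
  to \<open>n\<close>.
\<close>

section \<open>Horizontal and vertical steps\<close>

text \<open>A form of \<open>enhanced_step\<close> that reads two points instead of an index, so
  that the steps of a path form a list and induction applies.\<close>

definition estep :: "nat \<times> nat \<Rightarrow> nat \<times> nat \<Rightarrow> nat \<times> nat \<times> nat" where
  "estep p q = (if snd p = snd q then (fst p, fst q, snd p) else (snd p, snd q, fst p))"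

fun steps :: "(nat \<times> nat) list \<Rightarrow> (nat \<times> nat \<times> nat) list" where
  "steps (p # q # R) = estep p q # steps (q # R)"
| "steps _ = []"

definition compatible_steps :: "nat \<times> nat \<times> nat \<Rightarrow> nat \<times> nat \<times> nat \<Rightarrow> bool" where
  "compatible_steps = (\<lambda>(i, j, a) (x, y, z). x < j \<longrightarrow> j = z \<or> x = a)"

text \<open>Coherence freed from the end points and from the range \<open>{1..n}\<close>. In this
  form it passes to suffixes, to translates and to the mirror image in the diagonal.\<close>

definition coherent_chain :: "(nat \<times> nat) list \<Rightarrow> bool" where
  "coherent_chain P \<longleftrightarrow> (\<forall>p \<in> set P. fst p \<noteq> snd p) \<and> successively lattice_step P \<and>
     sorted_wrt compatible_steps (steps P)"

lemma length_steps: "length (steps P) = length P - 1"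
  by (induction P rule: steps.induct) auto

lemma nth_steps: "Suc k < length P \<Longrightarrow> steps P ! k = enhanced_step P k"
proof (induction P arbitrary: k rule: steps.induct)
  case (1 p q R)
  then show ?case
    by (cases k) (auto simp: enhanced_step_def estep_def)
qed auto

lemma coherent_path_iff:
  "coherent_path n P \<longleftrightarrow> P \<noteq> [] \<and> set P \<subseteq> {1..n} \<times> {1..n} \<and> hd P = (2, 1) \<and>
     last P \<in> {(n - 1, n), (n, n - 1)} \<and> coherent_chain P"
proof -
  have "sorted_wrt compatible_steps (steps P) \<longleftrightarrow>
      (\<forall>k m. k < m \<and> Suc m < length P \<longrightarrow> compatible_steps (enhanced_step P k) (enhanced_step P m))"
    by (auto simp: sorted_wrt_iff_nth_less length_steps nth_steps)
  also have "\<dots> \<longleftrightarrow> (\<forall>k m i j a x y z. k < m \<and> Suc m < length P \<and>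
      enhanced_step P k = (i, j, a) \<and> enhanced_step P m = (x, y, z) \<and> x < j \<longrightarrow> j = z \<or> x = a)"
    by (fastforce simp: compatible_steps_def split: prod.splits)
  finally show ?thesis
    unfolding coherent_path_def diagonal_avoiding_path_def coherent_chain_def by auto
qed

lemma coherent_chain_Cons:
  "coherent_chain (p # q # R) \<longleftrightarrow> fst p \<noteq> snd p \<and> lattice_step p q \<and>
     (\<forall>e \<in> set (steps (q # R)). compatible_steps (estep p q) e) \<and> coherent_chain (q # R)"
  by (auto simp: coherent_chain_def)

lemma coherent_chain_ge:
  "coherent_chain (p # R) \<Longrightarrow> q \<in> set (p # R) \<Longrightarrow> fst p \<le> fst q \<and> snd p \<le> snd q"
proof (induction R arbitrary: p)
  case (Cons r R)
  then show ?case
    by (fastforce simp: coherent_chain_Cons lattice_step_def)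
qed auto

lemma coherent_chain_le_last:
  "coherent_chain P \<Longrightarrow> q \<in> set P \<Longrightarrow> fst q \<le> fst (last P) \<and> snd q \<le> snd (last P)"
proof (induction P)
  case (Cons p P)
  show ?case
  proof (cases P)
    case (Cons r R)
    then show ?thesis
      using Cons.prems Cons.IH coherent_chain_ge[of p P "last P"]
      by (auto simp: coherent_chain_Cons)
  qed (use Cons.prems in auto)
qed auto

section \<open>Steps separated by the coordinate that changes\<close>

fun hsteps :: "(nat \<times> nat) list \<Rightarrow> (nat \<times> nat \<times> nat) set" where
  "hsteps (p # q # R) =
     (if snd p = snd q then {(fst p, fst q, snd p)} else {}) \<union> hsteps (q # R)"
| "hsteps _ = {}"

text \<open>Taken as the horizontal steps of the mirror image, so that facts about
  \<open>hsteps\<close> carry over through \<open>coherent_chain_swap\<close>.\<close>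

definition vsteps :: "(nat \<times> nat) list \<Rightarrow> (nat \<times> nat \<times> nat) set" where
  "vsteps P = hsteps (map prod.swap P)"

lemma vsteps_simps [simp]:
  "vsteps (p # q # R) = (if fst p = fst q then {(snd p, snd q, fst p)} else {}) \<union> vsteps (q # R)"
  "vsteps [p] = {}" "vsteps [] = {}"
  by (simp_all add: vsteps_def)

lemma estep_swap: "lattice_step p q \<Longrightarrow> estep (prod.swap p) (prod.swap q) = estep p q"
  by (auto simp: estep_def lattice_step_def)

lemma steps_swap: "successively lattice_step P \<Longrightarrow> steps (map prod.swap P) = steps P"
  by (induction P rule: steps.induct) (auto simp: estep_swap)

lemma coherent_chain_swap: "coherent_chain P \<Longrightarrow> coherent_chain (map prod.swap P)"
  by (auto simp: coherent_chain_def steps_swap successively_map lattice_step_def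
      elim: successively_mono)

lemma hsteps_subset: "hsteps P \<subseteq> set (steps P)"
  by (induction P rule: steps.induct) (auto simp: estep_def)

lemma vsteps_subset: "coherent_chain P \<Longrightarrow> vsteps P \<subseteq> set (steps P)"
  using hsteps_subset[of "map prod.swap P"]
  by (simp add: vsteps_def steps_swap coherent_chain_def)

lemma hstepsD:
  "coherent_chain P \<Longrightarrow> (i, j, a) \<in> hsteps P \<Longrightarrow> (i, a) \<in> set P \<and> (j, a) \<in> set P \<and> i < j \<and> i \<noteq> a \<and> j \<noteq> a"
proof (induction P rule: hsteps.induct)
  case (1 p q R)
  then show ?case
    by (cases p; cases q) (auto simp: coherent_chain_Cons lattice_step_def coherent_chain_def split: if_splits)
qed auto

lemma vstepsD:
  "coherent_chain P \<Longrightarrow> (i, j, a) \<in> vsteps P \<Longrightarrow> (a, i) \<in> set P \<and> (a, j) \<in> set P \<and> i < j \<and> i \<noteq> a \<and> j \<noteq> a"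
  using hstepsD[of "map prod.swap P" i j a] coherent_chain_swap[of P]
  by (auto simp: vsteps_def)

text \<open>
  The first disjunct is the case that the horizontal step comes first, the second one the case that
  the vertical step comes first.
\<close>

lemma hstep_vstep:
  assumes "coherent_chain P" "(i, j, a) \<in> hsteps P" "(x, y, z) \<in> vsteps P"
  shows "(j \<le> z \<and> a \<le> x \<and> (x < j \<longrightarrow> j = z \<or> x = a)) \<or> (z \<le> i \<and> y \<le> a \<and> (i < y \<longrightarrow> y = a \<or> i = z))"
  using assms
proof (induction P rule: hsteps.induct)
  case (1 p q R)
  have c: "coherent_chain (q # R)" "lattice_step p q"
    and cp: "\<And>e. e \<in> set (steps (q # R)) \<Longrightarrow> compatible_steps (estep p q) e"
    using 1(2) by (auto simp: coherent_chain_Cons)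
  consider "(i, j, a) \<in> hsteps (q # R)" "(x, y, z) \<in> vsteps (q # R)"
    | "(i, j, a) = (fst p, fst q, snd p)" "snd p = snd q" "(x, y, z) \<in> vsteps (q # R)"
    | "(i, j, a) \<in> hsteps (q # R)" "(x, y, z) = (snd p, snd q, fst p)" "fst p = fst q"
    using 1(3,4) c(2) by (auto simp: lattice_step_def split: if_splits)
  then show ?case
  proof cases
    case 1
    then show ?thesis using "1.IH" c by blast
  next
    case 2
    \<comment> \<open>The horizontal step is the first of the list, hence precedes the vertical one;
      monotonicity then yields \<open>j \<le> z\<close> and \<open>a \<le> x\<close>.\<close>
    have "compatible_steps (estep p q) (x, y, z)"
      using 2 vsteps_subset[OF c(1)] cp by blast
    moreover have "(z, x) \<in> set (q # R)"
      using 2 vstepsD[OF c(1)] by blast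
    ultimately show ?thesis
      using 2 coherent_chain_ge[OF c(1), of "(z, x)"] by (auto simp: compatible_steps_def estep_def)
  next
    case 3
    have "compatible_steps (estep p q) (i, j, a)"
      using 3 hsteps_subset[of "q # R"] cp by blast
    moreover have "(i, a) \<in> set (q # R)"
      using 3 hstepsD[OF c(1)] by blast
    ultimately show ?thesis
      using 3 coherent_chain_ge[OF c(1), of "(i, a)"] c(2)
      by (auto simp: compatible_steps_def estep_def lattice_step_def)
  qed
qed auto

text \<open>The last point with abscissa \<open>w\<close> is followed by a horizontal step, since
  the path has yet to reach \<open>w'\<close>; abscissae never decrease, so this step cannot jump
  over \<open>w'\<close>.\<close>

lemma hstep_from:
  assumes "coherent_chain P" "w \<in> fst ` set P" "w' \<in> fst ` set P" "w < w'"
  obtains j a where "(w, j, a) \<in> hsteps P" "j \<le> w'"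
proof -
  have "\<exists>j a. (w, j, a) \<in> hsteps P \<and> j \<le> w'"
    using assms
  proof (induction P rule: hsteps.induct)
    case (1 p q R)
    have c: "coherent_chain (q # R)" "lattice_step p q"
      using "1.prems" by (auto simp: coherent_chain_Cons)
    have pq: "fst p \<le> fst q"
      using c(2) by (auto simp: lattice_step_def)
    have w': "w' \<in> fst ` set (q # R)"
      using "1.prems" coherent_chain_ge[OF "1.prems"(1)] by force
    show ?case
    proof (cases "w \<in> fst ` set (q # R)")
      case True
      then show ?thesis using "1.IH"[OF c(1) _ w' assms(4)] by auto
    next
      case False
      then have "w = fst p" "fst p \<noteq> fst q"
        using "1.prems" by auto
      moreover have "fst q \<le> w'"
        using w' coherent_chain_ge[OF c(1)] by auto
      ultimately show ?thesis
        using c(2) by (intro exI[of _ "fst q"] exI[of _ "snd p"]) (auto simp: lattice_step_def)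
    qed
  qed auto
  then show ?thesis using that by blast
qed

lemma vstep_from:
  assumes "coherent_chain P" "w \<in> snd ` set P" "w' \<in> snd ` set P" "w < w'"
  obtains j a where "(w, j, a) \<in> vsteps P" "j \<le> w'"
proof (rule hstep_from[of "map prod.swap P" w w'])
  show "coherent_chain (map prod.swap P)"
    using assms(1) by (rule coherent_chain_swap)
qed (use assms that in \<open>force simp: vsteps_def\<close>)+

text \<open>Such a step starts at the point \<open>(i, a)\<close>, to which a strictly increasing
  path never returns, so it is the first step. This turns membership in \<open>hsteps\<close> into
  knowledge of the next point.\<close>

lemma hstep_head:
  assumes "coherent_chain ((i, a) # R)" "(i, j, a) \<in> hsteps ((i, a) # R)"
  obtains R' where "R = (j, a) # R'"
proof (cases R)
  case (Cons q R')
  have "coherent_chain (q # R')" "lattice_step (i, a) q"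
    using assms(1) Cons by (auto simp: coherent_chain_Cons)
  moreover have False if "(i, j, a) \<in> hsteps (q # R')"
    using hstepsD[OF calculation(1) that] coherent_chain_ge[OF calculation(1), of "(i, a)"]
      calculation(2) by (auto simp: lattice_step_def)
  ultimately show ?thesis
    using assms(2) Cons that by (cases q) (auto split: if_splits)
qed (use assms in auto)

lemma vstep_head:
  assumes "coherent_chain ((a, i) # R)" "(i, j, a) \<in> vsteps ((a, i) # R)"
  obtains R' where "R = (a, j) # R'"
proof (rule hstep_head[of i a "map prod.swap R" j])
  show "coherent_chain ((i, a) # map prod.swap R)"
    using coherent_chain_swap[OF assms(1)] by simp
  show "(i, j, a) \<in> hsteps ((i, a) # map prod.swap R)"
    using assms(2) by (simp add: vsteps_def)
qed (use that in \<open>auto simp: map_eq_Cons_conv\<close>)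

text \<open>Every step brings one new value into one of the coordinates, and a single point already
  has two values; hence the 1.\<close>

lemma length_eq_coordinates:
  assumes "coherent_chain P" "P \<noteq> []"
  shows "length P + 1 = card (fst ` set P) + card (snd ` set P)"
  using assms
proof (induction P rule: steps.induct)
  case (1 p q R)
  have c: "coherent_chain (q # R)" "lattice_step p q"
    using "1.prems" by (auto simp: coherent_chain_Cons)
  then have ih: "length (q # R) + 1 = card (fst ` set (q # R)) + card (snd ` set (q # R))"
    using "1.IH" by blast
  \<comment> \<open>The coordinate that changes leaves its old value for good, while the other value
    is shared with \<open>q\<close>.\<close>
  have "(fst p \<notin> fst ` set (q # R) \<and> snd p \<in> snd ` set (q # R)) \<or>
      (fst p \<in> fst ` set (q # R) \<and> snd p \<notin> snd ` set (q # R))"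
    using c(2) coherent_chain_ge[OF c(1)] by (fastforce simp: lattice_step_def)
  then show ?case
    using ih by (auto simp: card_insert_if simp del: set_simps simp add: list.set(2)[of p])
qed (auto simp: coherent_chain_def)

section \<open>The length bound\<close>

definition visits :: "(nat \<times> nat) list \<Rightarrow> nat \<Rightarrow> nat" where
  "visits P w = of_bool (w \<in> fst ` set P) + of_bool (w \<in> snd ` set P)"

text \<open>If all four visits occurred, there would be a horizontal and a vertical step from
  \<open>w\<close> to \<open>w + 1\<close>. Whichever comes first, coherence makes a fixed
  coordinate equal to \<open>w\<close> or \<open>w + 1\<close>, so one of the steps would touch the
  diagonal.\<close>

lemma visits_pair_le:
  assumes "coherent_chain P"
  shows "visits P w + visits P (Suc w) \<le> 3"
proof (rule ccontr)
  assume "\<not> ?thesis"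
  then have *: "w \<in> fst ` set P" "Suc w \<in> fst ` set P" "w \<in> snd ` set P" "Suc w \<in> snd ` set P"
    unfolding visits_def by (auto simp: of_bool_def split: if_splits)
  obtain j a where h: "(w, j, a) \<in> hsteps P" "j \<le> Suc w"
    using hstep_from[OF assms *(1,2)] by auto
  obtain y z where v: "(w, y, z) \<in> vsteps P" "y \<le> Suc w"
    using vstep_from[OF assms *(3,4)] by auto
  show False
    using hstep_vstep[OF assms h(1) v(1)] hstepsD[OF assms h(1)] vstepsD[OF assms v(1)] h(2) v(2)
    by auto
qed

text \<open>The sum splits into \<open>m\<close> pairs, each at most 3; it can reach
  \<open>3 * m\<close> only if no pair falls short.\<close>

lemma sum_pairs:
  fixes c :: "nat \<Rightarrow> nat"
  assumes "\<And>w. c w + c (Suc w) \<le> 3"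
  shows "(\<Sum>w = 2..<2 * m + 2. c w) \<le> 3 * m"
    and "(\<Sum>w = 2..<2 * m + 2. c w) = 3 * m \<Longrightarrow> k < m \<Longrightarrow> c (2 * k + 2) + c (2 * k + 3) = 3"
proof -
  have eq: "(\<Sum>w = 2..<2 * m + 2. c w) = (\<Sum>k<m. c (2 * k + 2) + c (2 * k + 3))" for m
    by (induction m) (simp_all add: eval_nat_numeral)
  have le: "c (2 * k + 2) + c (2 * k + 3) \<le> 3" for k
    using assms[of "2 * k + 2"] by (simp add: eval_nat_numeral)
  show "(\<Sum>w = 2..<2 * m + 2. c w) \<le> 3 * m"
    unfolding eq using sum_bounded_above[of "{..<m}", OF le] by (simp add: mult.commute)
  assume "(\<Sum>w = 2..<2 * m + 2. c w) = 3 * m" "k < m"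
  then have "(\<Sum>k<m. c (2 * k + 2) + c (2 * k + 3)) = (\<Sum>k<m. 3)"
    unfolding eq by simp
  then show "c (2 * k + 2) + c (2 * k + 3) = 3"
    using sum_mono_inv[of "\<lambda>k. c (2 * k + 2) + c (2 * k + 3)" "{..<m}" "\<lambda>_. 3" k] le \<open>k < m\<close>
    by simp
qed

text \<open>Abscissae start at 2, so 1 occurs only as an ordinate. Both coordinates are largest at
  the last point, where exactly one of them is \<open>n\<close>.\<close>

lemma coherent_path_visits:
  assumes "coherent_path n P" "n \<ge> 2"
  shows "length P + 1 = (\<Sum>w = 1..n. visits P w)"
    and "visits P 1 = 1" and "visits P n = 1"
proof -
  have P: "P \<noteq> []" "set P \<subseteq> {1..n} \<times> {1..n}" "hd P = (2, 1)"
    "last P \<in> {(n - 1, n), (n, n - 1)}" "coherent_chain P"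
    using assms(1) by (auto simp: coherent_path_iff)
  have *: "(\<Sum>w = 1..n. of_bool (w \<in> A)) = card A" if "A \<subseteq> {1..n}" for A :: "nat set"
    using that by (simp add: of_bool_def sum.If_cases Int_absorb1)
  have "fst ` set P \<subseteq> {1..n}" "snd ` set P \<subseteq> {1..n}"
    using P(2) by auto
  then show "length P + 1 = (\<Sum>w = 1..n. visits P w)"
    unfolding visits_def sum.distrib using length_eq_coordinates[OF P(5,1)] by (simp only: *)
  obtain R where R: "P = (2, 1) # R"
    using P(1,3) by (cases P) auto
  have "2 \<le> fst p" if "p \<in> set P" for p
    using coherent_chain_ge[of "(2, 1)" R p] P(5) that unfolding R by auto
  then have "1 \<notin> fst ` set P"
    by force
  moreover have "1 \<in> snd ` set P"
    unfolding R by force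
  ultimately show "visits P 1 = 1"
    by (simp add: visits_def)
  have last: "last P \<in> set P"
    using P(1) by simp
  have le: "fst p \<le> fst (last P) \<and> snd p \<le> snd (last P)" if "p \<in> set P" for p
    using coherent_chain_le_last[OF P(5) that] .
  consider "last P = (n - 1, n)" | "last P = (n, n - 1)"
    using P(4) by auto
  then have "(n \<in> fst ` set P) = (n \<notin> snd ` set P)"
  proof cases
    case 1
    then have "n \<in> snd ` set P" "n \<notin> fst ` set P"
      using last le assms(2) by force+
    then show ?thesis by simp
  next
    case 2
    then have "n \<in> fst ` set P" "n \<notin> snd ` set P"
      using last le assms(2) by force+
    then show ?thesis by simp
  qed
  then show "visits P n = 1"
    by (auto simp: visits_def)
qed

text \<open>For odd \<open>n\<close> the values are 1 and \<open>m\<close> pairs, the last pair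
  ending in \<open>n\<close>, so there are at most \<open>3 * m + 1\<close> visits. For even
  \<open>n\<close> the value \<open>n\<close> is left over and adds one visit. The length is one
  less than the number of visits.\<close>

lemma coherent_path_length:
  assumes "coherent_path n P" "n \<ge> 2"
  shows "length P \<le> 3 * (n - 1) div 2"
    and "length P = 3 * (n - 1) div 2 \<Longrightarrow> 2 * k + 3 \<le> n \<Longrightarrow>
      visits P (2 * k + 2) + visits P (2 * k + 3) = 3"
proof -
  define m where "m = (n - 1) div 2"
  have c: "coherent_chain P"
    using assms(1) by (simp add: coherent_path_iff)
  note v = coherent_path_visits[OF assms]
  note s = sum_pairs[where c = "visits P" and m = m, OF visits_pair_le[OF c]]
  have "odd n \<and> n = 2 * m + 1 \<or> even n \<and> n = 2 * m + 2"
    using assms(2) unfolding m_def by presburger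
  then consider "odd n" "n = 2 * m + 1" | "even n" "n = 2 * m + 2"
    by blast
  then have "length P \<le> 3 * (n - 1) div 2 \<and> (length P = 3 * (n - 1) div 2 \<longrightarrow> 2 * k + 3 \<le> n \<longrightarrow>
      visits P (2 * k + 2) + visits P (2 * k + 3) = 3)"
  proof cases
    case 1
    then have "{1..n} = insert 1 {2..<2 * m + 2}"
      by auto
    then show ?thesis
      using v(1,2) s(1) s(2)[of k] 1 by simp
  next
    case 2
    then have "{1..n} = insert 1 (insert n {2..<2 * m + 2})"
      by auto
    then have *: "length P + 1 = 2 + (\<Sum>w = 2..<2 * m + 2. visits P w)"
      unfolding v(1) using v(2,3) 2 by simp
    have "length P = 3 * m + 1 \<longrightarrow> 2 * k + 3 \<le> n \<longrightarrow>
        visits P (2 * k + 2) + visits P (2 * k + 3) = 3"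
      using * s(2)[of k] 2 by linarith
    moreover have "length P \<le> 3 * m + 1"
      using * s(1) by linarith
    moreover have "3 * (n - 1) div 2 = 3 * m + 1"
      using 2 by simp
    ultimately show ?thesis
      by metis
  qed
  then show "length P \<le> 3 * (n - 1) div 2"
    and "length P = 3 * (n - 1) div 2 \<Longrightarrow> 2 * k + 3 \<le> n \<Longrightarrow>
      visits P (2 * k + 2) + visits P (2 * k + 3) = 3"
    by blast+
qed

section \<open>The first points of a longest path\<close>

text \<open>The points of a monotone path form a chain in the product order. This locates a step
  once a later or earlier one is known.\<close>

lemma coherent_chain_comparable:
  "coherent_chain P \<Longrightarrow> p \<in> set P \<Longrightarrow> q \<in> set P \<Longrightarrow>
     (fst p \<le> fst q \<and> snd p \<le> snd q) \<or> (fst q \<le> fst p \<and> snd q \<le> snd p)"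
proof (induction P)
  case (Cons r P)
  show ?case
  proof (cases "p = r \<or> q = r")
    case True
    then show ?thesis
      using coherent_chain_ge[OF Cons.prems(1)] Cons.prems(2,3) by metis
  next
    case False
    then show ?thesis
      using Cons by (cases P) (auto simp: coherent_chain_Cons)
  qed
qed auto

text \<open>
  Also true of one-point paths: for size 2 the path \<open>[(2, 1)]\<close> must count as starting vertically.
\<close>

definition vertical_start :: "(nat \<times> nat) list \<Rightarrow> bool" where
  "vertical_start P \<longleftrightarrow> (\<forall>p q R. P = p # q # R \<longrightarrow> fst q = fst p)"

text \<open>Of the four possible visits to 2 and 3 exactly one is missing, and
  \<open>2 \<in> X\<close> always holds; this gives the cases A, B and C. In each case the short
  steps leaving 1, 2 and 3 clash unless they lie at fixed places, which determines the first points.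
  In case C the order of two steps remains free.\<close>

lemma max_path_prefix:
  assumes P: "coherent_path n P" and n: "n \<ge> 4" and len: "length P = 3 * (n - 1) div 2"
  obtains
    (right_turn) R where "P = (2, 1) # (3, 1) # (3, 2) # (3, 4) # R"
  | (right_right) R where "P = (2, 1) # (3, 1) # (4, 1) # (4, 3) # R" "vertical_start ((4, 3) # R)"
  | (long_right) R where "P = (2, 1) # (4, 1) # (4, 2) # (4, 3) # R" "vertical_start ((4, 3) # R)"
  | (up_up) R where "P = (2, 1) # (2, 3) # (2, 4) # (3, 4) # R"
      "vertical_start (map prod.swap ((3, 4) # R))"
proof -
  define X where "X = fst ` set P"
  define Y where "Y = snd ` set P"
  have c: "coherent_chain P" and sub: "set P \<subseteq> {1..n} \<times> {1..n}"
    and last: "last P \<in> {(n - 1, n), (n, n - 1)}" "last P \<in> set P"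
    using P by (auto simp: coherent_path_iff)
  obtain S where S: "P = (2, 1) # S"
    using P by (cases P) (auto simp: coherent_path_iff)
  have diag: "p \<in> set P \<Longrightarrow> fst p \<noteq> snd p" for p
    using c by (simp add: coherent_chain_def)
  have ge: "p \<in> set P \<Longrightarrow> 2 \<le> fst p \<and> 1 \<le> snd p" for p
    using coherent_chain_ge[of "(2, 1)" S p] c unfolding S by auto
  have XY: "p \<in> set P \<Longrightarrow> fst p \<in> X \<and> snd p \<in> Y \<and> fst p \<le> n \<and> snd p \<le> n" for p
    using sub by (auto simp: X_def Y_def)
  have start: "2 \<in> X" "1 \<in> Y"
    unfolding X_def Y_def S by force+
  obtain tx where tx: "tx \<in> X" "n - 1 \<le> tx"
    using XY[OF last(2)] last(1) by force
  obtain ty where ty: "ty \<in> Y" "n - 1 \<le> ty"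
    using XY[OF last(2)] last(1) by force
  \<comment> \<open>For \<open>n > 4\<close> the path goes beyond 3 in both coordinates, so steps
    leaving the value 3 exist. For \<open>n = 4\<close> the bound on the coordinates replaces this
    argument below.\<close>
  have tx3: "3 < tx" and ty3: "3 < ty" if "n \<noteq> 4"
    using tx(2) ty(2) n that by arith+
  have final: "(n - 1 \<in> X \<and> n \<in> Y) \<or> (n \<in> X \<and> n - 1 \<in> Y)"
    using XY[OF last(2)] last(1) by force
  have H: "i \<in> X \<and> j \<in> X \<and> a \<in> Y \<and> i < j \<and> i \<noteq> a \<and> j \<noteq> a \<and> 2 \<le> i \<and> 1 \<le> a \<and> j \<le> n \<and> a \<le> n
      \<and> (i, a) \<in> set P \<and> (j, a) \<in> set P"
    if "(i, j, a) \<in> hsteps P" for i j a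
    using hstepsD[OF c that] XY[of "(i, a)"] XY[of "(j, a)"] ge[of "(i, a)"] by auto
  have V: "i \<in> Y \<and> j \<in> Y \<and> a \<in> X \<and> i < j \<and> i \<noteq> a \<and> j \<noteq> a \<and> 1 \<le> i \<and> 2 \<le> a \<and> j \<le> n \<and> a \<le> n
      \<and> (a, i) \<in> set P \<and> (a, j) \<in> set P"
    if "(i, j, a) \<in> vsteps P" for i j a
    using vstepsD[OF c that] XY[of "(a, i)"] XY[of "(a, j)"] ge[of "(a, i)"] by auto
  have comp: "(x \<le> x' \<and> y \<le> y') \<or> (x' \<le> x \<and> y' \<le> y)"
    if "(x, y) \<in> set P" "(x', y') \<in> set P" for x y x' y'
    using coherent_chain_comparable[OF c that] by simp
  note HV = hstep_vstep[OF c]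
  have h_ex: "\<exists>j a. (w, j, a) \<in> hsteps P \<and> j \<le> w'" if "w \<in> X" "w' \<in> X" "w < w'" for w w'
    using hstep_from[OF c that[unfolded X_def]] by metis
  have v_ex: "\<exists>j a. (w, j, a) \<in> vsteps P \<and> j \<le> w'" if "w \<in> Y" "w' \<in> Y" "w < w'" for w w'
    using vstep_from[OF c that[unfolded Y_def]] by metis
  have vis: "visits P w = of_bool (w \<in> X) + of_bool (w \<in> Y)" for w
    by (simp add: visits_def X_def Y_def)
  have "visits P 2 + visits P 3 = 3"
    using coherent_path_length(2)[OF P _ len, of 0] n by (simp only: mult_0_right add_0)
  then have c23: "(2 \<in> Y \<and> (3 \<in> X) \<noteq> (3 \<in> Y)) \<or> (2 \<notin> Y \<and> 3 \<in> X \<and> 3 \<in> Y)"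
    using start(1) by (cases "2 \<in> Y"; cases "3 \<in> X"; cases "3 \<in> Y") (simp_all add: vis)
  \<comment> \<open>If 4 is visited only once, then 5 is visited twice.\<close>
  have c45: "((4 \<in> X) \<noteq> (4 \<in> Y) \<and> 5 \<in> X \<and> 5 \<in> Y) \<or> (4 \<in> X \<and> 4 \<in> Y)" if "n \<noteq> 4"
  proof -
    have "visits P 4 + visits P 5 = 3"
      using coherent_path_length(2)[OF P _ len, of 1] n that
      by (simp only: mult_1_right numeral_plus_numeral add_num_simps)
    then show ?thesis
      by (cases "4 \<in> X"; cases "4 \<in> Y"; cases "5 \<in> X"; cases "5 \<in> Y") (simp_all add: vis)
  qed
  \<comment> \<open>A horizontal step into 4 at height 1 forces the vertical step leaving height 3
    to lie at abscissa 4. A path that went right from \<open>(4, 3)\<close> could not contain the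
    upper end of that step.\<close>
  have vert: "vertical_start ((4, 3) # R)"
    if "(i, 4, 1) \<in> hsteps P" "i \<le> 3" and R: "P = A @ (4, 3) # R" for i R A
    unfolding vertical_start_def
  proof (intro allI impI)
    fix p q R'
    assume "(4, 3) # R = p # q # R'"
    then have *: "p = (4, 3)" "R = q # R'"
      by auto
    have q: "q \<in> set P" "lattice_step (4, 3) q"
      using c unfolding coherent_chain_def R * by (auto simp: successively_append_iff)
    show "fst q = fst p"
    proof (cases "n = 4")
      case True
      then show ?thesis
        using q XY[OF q(1)] diag[OF q(1)] by (auto simp: lattice_step_def *)
    next
      case False
      have "3 \<in> Y"
        using XY[of "(4, 3)"] R by auto
      then obtain y z where v: "(3, y, z) \<in> vsteps P"
        using v_ex[OF _ ty(1) ty3[OF False]] by blast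
      then have "z = 4"
        using HV[OF that(1) v] V[OF v] by auto
      then have "(4, y) \<in> set P" "3 < y"
        using V[OF v] by auto
      then show ?thesis
        using comp[of "fst q" "snd q" 4 y] q by (auto simp: lattice_step_def *)
    qed
  qed
  consider (A) "2 \<in> Y" "3 \<in> X" "3 \<notin> Y" | (B) "2 \<in> Y" "3 \<in> Y" "3 \<notin> X" | (C) "2 \<notin> Y" "3 \<in> X" "3 \<in> Y"
    using c23 by blast
  then show ?thesis
  proof cases
    case A
    obtain z1 where v1: "(1, 2, z1) \<in> vsteps P"
    proof -
      obtain j z where *: "(1, j, z) \<in> vsteps P" "j \<le> 2"
        using v_ex[of 1 2] start A by auto
      then have "j = 2" using V[of 1 j z] by simp
      then show thesis using * that by blast
    qed
    obtain a where h1: "(2, 3, a) \<in> hsteps P"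
    proof -
      obtain j a where *: "(2, j, a) \<in> hsteps P" "j \<le> 3"
        using h_ex[of 2 3] start A by auto
      then have "j = 3" using H[of 2 j a] by simp
      then show thesis using * that by blast
    qed
    \<comment> \<open>With the vertical step first, \<open>z1 = 2\<close> would follow and that step
      would end on the diagonal. So the horizontal step comes first.\<close>
    have z1: "a = 1" "3 \<le> z1"
      using HV[OF h1 v1] H[OF h1] V[OF v1] by auto
    \<comment> \<open>A value that the ordinate takes after 2: it is 4 or, failing that, 5 by
      \<open>c45\<close>; for \<open>n = 4\<close>, \<open>final\<close> gives 3 or 4.\<close>
    define w where "w = (if 4 \<in> Y then 4 else if n = 4 then 3 else 5 :: nat)"
    have w: "w \<in> Y" "2 < w"
      using A c45 final by (cases "n = 4"; auto simp: w_def)+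
    obtain y z2 where v2: "(2, y, z2) \<in> vsteps P" "y \<le> w"
      using v_ex[OF A(1) w] by blast
    have z2: "z2 = 3"
      using HV[OF h1 v2(1)] H[OF h1] V[OF v2(1)] z1 by auto
    then have z13: "z1 = 3"
      using comp[of z1 1 z2 y] V[OF v1] V[OF v2(1)] z1 by auto
    \<comment> \<open>Otherwise the vertical step leaving 2 at abscissa 3 would end at 5, and
      coherence would push the horizontal step from 4 to 5 to height 5, where it ends on the
      diagonal. Cases B and C exclude a missing 4 by the same kind of clash.\<close>
    have "4 \<in> Y"
    proof (rule ccontr)
      assume 4: "4 \<notin> Y"
      have n4: "n \<noteq> 4" using 4 A final by auto
      then have 5: "4 \<in> X" "5 \<in> X" "5 \<in> Y"
        using c45 4 by auto
      have y: "y = 5"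
        using V[OF v2(1)] v2(2) n4 4 A z2 by (cases "y = 3 \<or> y = 4") (auto simp: w_def)
      obtain r j where r: "(4, j, r) \<in> hsteps P" "j \<le> 5"
        using h_ex[of 4 5] 5 by auto
      show False
        using HV[OF r(1) v2(1)] H[OF r(1)] r(2) by (auto simp: y z2)
    qed
    then have "y = 4"
      using V[OF v2(1)] v2(2) z2 by (auto simp: w_def)
    then have steps: "(2, 3, 1) \<in> hsteps P" "(1, 2, 3) \<in> vsteps P" "(2, 4, 3) \<in> vsteps P"
      using h1 v1 v2 z1 z2 z13 by auto
    obtain R1 where R1: "S = (3, 1) # R1"
      using hstep_head[of 2 1 S 3] c steps unfolding S by blast
    have c1: "coherent_chain ((3, 1) # R1)"
      using c unfolding S R1 by (simp add: coherent_chain_Cons)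
    obtain R2 where R2: "R1 = (3, 2) # R2"
      using vstep_head[OF c1, of 2] steps unfolding S R1 by auto
    have c2: "coherent_chain ((3, 2) # R2)"
      using c1 unfolding R2 by (simp add: coherent_chain_Cons)
    obtain R3 where R3: "R2 = (3, 4) # R3"
      using vstep_head[OF c2, of 4] steps unfolding S R1 R2 by auto
    show ?thesis
      using right_turn[of R3] unfolding S R1 R2 R3 by blast
  next
    case B
    obtain z1 where v1: "(1, 2, z1) \<in> vsteps P"
    proof -
      obtain j z where *: "(1, j, z) \<in> vsteps P" "j \<le> 2"
        using v_ex[of 1 2] start B by auto
      then have "j = 2" using V[of 1 j z] by simp
      then show thesis using * that by blast
    qed
    obtain z2 where v2: "(2, 3, z2) \<in> vsteps P"
    proof -
      obtain j a where *: "(2, j, a) \<in> vsteps P" "j \<le> 3"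
        using v_ex[of 2 3] B by auto
      then have "j = 3" using V[of 2 j a] by simp
      then show thesis using * that by blast
    qed
    define w where "w = (if 4 \<in> X then 4 else 5 :: nat)"
    have w: "w \<in> X" "2 < w"
      using B c45 final by (cases "n = 4"; auto simp: w_def)+
    obtain q a where h1: "(2, q, a) \<in> hsteps P" "q \<le> w"
      using h_ex[OF start(1) w] by blast
    have q4: "4 \<le> q"
      using H[OF h1(1)] B(3) by (cases "q = 3") auto
    have a: "a = 1" "q \<le> z1"
      using HV[OF h1(1) v1] H[OF h1(1)] V[OF v1] by auto
    \<comment> \<open>Coherence requires \<open>z2 = q\<close> or \<open>a = 2\<close>, and
      \<open>a = 1\<close>. The vertical step below it lies at abscissa at least \<open>q\<close>
      and cannot lie further right.\<close>
    have z2: "z2 = q"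
      using HV[OF h1(1) v2] H[OF h1(1)] V[OF v2] by auto
    then have z1: "z1 = q"
      using comp[of z1 1 z2 3] V[OF v1] V[OF v2] a by auto
    have "4 \<in> X"
    proof (rule ccontr)
      assume 4: "4 \<notin> X"
      have "n \<noteq> 4" using 4 B final by auto
      then have 5: "4 \<in> Y" "5 \<in> X" "5 \<in> Y"
        using c45 4 by auto
      have q: "q = 5"
        using h1(2) q4 4 H[OF h1(1)] by (cases "q = 4") (auto simp: w_def)
      obtain r j where r: "(4, j, r) \<in> vsteps P" "j \<le> 5"
        using v_ex[of 4 5] 5 by auto
      show False
        using HV[OF h1(1) r(1)] V[OF r(1)] r(2) by (auto simp: q a)
    qed
    then have "q = 4"
      using h1 q4 by (auto simp: w_def)
    then have steps: "(2, 4, 1) \<in> hsteps P" "(1, 2, 4) \<in> vsteps P" "(2, 3, 4) \<in> vsteps P"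
      using h1 v1 v2 z1 z2 a by auto
    obtain R1 where R1: "S = (4, 1) # R1"
      using hstep_head[of 2 1 S 4] c steps unfolding S by blast
    have c1: "coherent_chain ((4, 1) # R1)"
      using c unfolding S R1 by (simp add: coherent_chain_Cons)
    obtain R2 where R2: "R1 = (4, 2) # R2"
      using vstep_head[OF c1, of 2] steps unfolding S R1 by auto
    have c2: "coherent_chain ((4, 2) # R2)"
      using c1 unfolding R2 by (simp add: coherent_chain_Cons)
    obtain R3 where R3: "R2 = (4, 3) # R3"
      using vstep_head[OF c2, of 3] steps unfolding S R1 R2 by auto
    have "vertical_start ((4, 3) # R3)"
      by (rule vert[OF steps(1), of "[(2, 1), (4, 1), (4, 2)]"]) (simp_all add: S R1 R2 R3)
    then show ?thesis
      using long_right[of R3] unfolding S R1 R2 R3 by blast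
  next
    case C
    obtain a where h1: "(2, 3, a) \<in> hsteps P"
    proof -
      obtain j a where *: "(2, j, a) \<in> hsteps P" "j \<le> 3"
        using h_ex[of 2 3] start C by auto
      then have "j = 3" using H[of 2 j a] by simp
      then show thesis using * that by blast
    qed
    obtain b where v1: "(1, 3, b) \<in> vsteps P"
    proof -
      obtain j a where *: "(1, j, a) \<in> vsteps P" "j \<le> 3"
        using v_ex[of 1 3] start C by auto
      moreover have "j \<noteq> 2" using V[OF *(1)] C by auto
      ultimately have "j = 3" using V[of 1 j a] by simp
      then show thesis using * that by blast
    qed
    have "3 \<le> b \<and> a \<le> 1 \<or> b \<le> 2 \<and> 3 \<le> a" "1 \<le> a" "2 \<le> b" "a \<noteq> 3" "b \<noteq> 3"
      using HV[OF h1 v1] H[OF h1] V[OF v1] by blast+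
    \<comment> \<open>Either the horizontal step from 2 to 3 comes first, or the vertical step from
      1 to 3 does.\<close>
    then consider (right) "a = 1" "4 \<le> b" | (up) "b = 2" "4 \<le> a"
      by linarith
    then show ?thesis
    proof cases
      case right
      have bX: "b \<in> X" "b \<le> n"
        using V[OF v1] by auto
      have 4: "4 \<in> X"
      proof (rule ccontr)
        assume 4: "4 \<notin> X"
        have "n \<noteq> 4" using 4 right bX by (cases "b = 4") auto
        then have 5: "4 \<in> Y" "5 \<in> X" "5 \<in> Y"
          using c45 4 by auto
        obtain q a' where h2: "(3, q, a') \<in> hsteps P" "q \<le> 5"
          using h_ex[of 3 5] 5 C by auto
        have q: "q = 5"
          using H[OF h2(1)] h2(2) 4 by (cases "q = 4") auto
        have a': "a' = 1"
          using HV[OF h2(1) v1] H[OF h2(1)] right by auto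
        obtain r j where r: "(4, j, r) \<in> vsteps P" "j \<le> 5"
          using v_ex[of 4 5] 5 by auto
        show False
          using HV[OF h2(1) r(1)] V[OF r(1)] r(2) by (auto simp: q a')
      qed
      obtain q a' where h2: "(3, q, a') \<in> hsteps P" "q \<le> 4"
        using h_ex[of 3 4] 4 C by auto
      have q: "q = 4"
        using H[OF h2(1)] h2(2) by auto
      have a': "a' = 1"
        using HV[OF h2(1) v1] H[OF h2(1)] right by auto
      \<comment> \<open>The vertical step leaving height 3 lies at abscissa 4, so the lower one at
        \<open>b\<close> cannot lie further right. For \<open>n = 4\<close> the bound
        \<open>b \<le> n\<close> settles it.\<close>
      have b: "b = 4"
      proof (cases "n = 4")
        case False
        then obtain y z where v2: "(3, y, z) \<in> vsteps P"
          using v_ex[OF C(3) ty(1) ty3[OF False]] by blast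
        have "z = 4"
          using HV[OF h2(1) v2] V[OF v2] by (auto simp: q a')
        then show ?thesis
          using comp[of b 1 4 y] V[OF v1] V[OF v2] right by auto
      qed (use right bX in auto)
      have steps: "(2, 3, 1) \<in> hsteps P" "(3, 4, 1) \<in> hsteps P" "(1, 3, 4) \<in> vsteps P"
        using h1 h2 v1 right q a' b by auto
      obtain R1 where R1: "S = (3, 1) # R1"
        using hstep_head[of 2 1 S 3] c steps unfolding S by blast
      have c1: "coherent_chain ((3, 1) # R1)"
        using c unfolding S R1 by (simp add: coherent_chain_Cons)
      obtain R2 where R2: "R1 = (4, 1) # R2"
        using hstep_head[OF c1, of 4] steps unfolding S R1 by auto
      have c2: "coherent_chain ((4, 1) # R2)"
        using c1 unfolding R2 by (simp add: coherent_chain_Cons)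
      obtain R3 where R3: "R2 = (4, 3) # R3"
        using vstep_head[OF c2, of 3] steps unfolding S R1 R2 by auto
      have "vertical_start ((4, 3) # R3)"
        by (rule vert[OF steps(2), of "[(2, 1), (3, 1), (4, 1)]"]) (simp_all add: S R1 R2 R3)
      then show ?thesis
        using right_right[of R3] unfolding S R1 R2 R3 by blast
    next
      case up
      have aY: "a \<in> Y" "a \<le> n"
        using H[OF h1] by auto
      have 4: "4 \<in> Y"
      proof (rule ccontr)
        assume 4: "4 \<notin> Y"
        have "n \<noteq> 4" using 4 up aY by (cases "a = 4") auto
        then have 5: "4 \<in> X" "5 \<in> X" "5 \<in> Y"
          using c45 4 by auto
        obtain q b' where v2: "(3, q, b') \<in> vsteps P" "q \<le> 5"
          using v_ex[of 3 5] 5 C by auto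
        have q: "q = 5"
          using V[OF v2(1)] v2(2) 4 by (cases "q = 4") auto
        have b': "b' = 2"
          using HV[OF h1 v2(1)] V[OF v2(1)] up by auto
        obtain r j where r: "(4, j, r) \<in> hsteps P" "j \<le> 5"
          using h_ex[of 4 5] 5 by auto
        show False
          using HV[OF r(1) v2(1)] H[OF r(1)] r(2) by (auto simp: q b')
      qed
      obtain q b' where v2: "(3, q, b') \<in> vsteps P" "q \<le> 4"
        using v_ex[of 3 4] 4 C by auto
      have q: "q = 4"
        using V[OF v2(1)] v2(2) by auto
      have b': "b' = 2"
        using HV[OF h1 v2(1)] V[OF v2(1)] up by auto
      \<comment> \<open>The vertical step from 3 to 4 at abscissa 2 forces the horizontal step
        leaving 3 to height 4. This gives both \<open>a = 4\<close> and the direction after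
        \<open>(3, 4)\<close>.\<close>
      have h2: "\<exists>x. (3, x, 4) \<in> hsteps P" if "n \<noteq> 4"
      proof -
        obtain x a' where h2: "(3, x, a') \<in> hsteps P"
          using h_ex[OF C(2) tx(1) tx3[OF \<open>n \<noteq> 4\<close>]] by blast
        moreover have "a' = 4"
          using HV[OF h2 v2(1)] H[OF h2] by (auto simp: q b')
        ultimately show ?thesis by blast
      qed
      have a: "a = 4"
      proof (cases "n = 4")
        case False
        then obtain x where "(3, x, 4) \<in> hsteps P"
          using h2 by blast
        then show ?thesis
          using comp[of 2 a x 4] H[OF h1] H[of 3 x 4] up by auto
      qed (use up aY in auto)
      have steps: "(1, 3, 2) \<in> vsteps P" "(3, 4, 2) \<in> vsteps P" "(2, 3, 4) \<in> hsteps P"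
        using h1 v1 v2 up q a b' by auto
      obtain R1 where R1: "S = (2, 3) # R1"
        using vstep_head[of 2 1 S 3] c steps unfolding S by blast
      have c1: "coherent_chain ((2, 3) # R1)"
        using c unfolding S R1 by (simp add: coherent_chain_Cons)
      obtain R2 where R2: "R1 = (2, 4) # R2"
        using vstep_head[OF c1, of 4] steps unfolding S R1 by auto
      have c2: "coherent_chain ((2, 4) # R2)"
        using c1 unfolding R2 by (simp add: coherent_chain_Cons)
      obtain R3 where R3: "R2 = (3, 4) # R3"
        using hstep_head[OF c2, of 3] steps unfolding S R1 R2 by auto
      have c3: "coherent_chain ((3, 4) # R3)"
        using c2 unfolding R3 by (simp add: coherent_chain_Cons)
      have "snd r = 4" if R: "R3 = r # R'" for r R'
      proof -
        have r: "r \<in> set P" "lattice_step (3, 4) r"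
          using c3 unfolding S R1 R2 R3 R by (auto simp: coherent_chain_Cons)
        show ?thesis
        proof (cases "n = 4")
          case True
          then show ?thesis
            using r XY[OF r(1)] by (auto simp: lattice_step_def)
        next
          case False
          then obtain x where "(3, x, 4) \<in> hsteps P"
            using h2 by blast
          then show ?thesis
            using comp[of "fst r" "snd r" x 4] H[of 3 x 4] r by (auto simp: lattice_step_def)
        qed
      qed
      then have "vertical_start (map prod.swap ((3, 4) # R3))"
        by (auto simp: vertical_start_def)
      then show ?thesis
        using up_up[of R3] unfolding S R1 R2 R3 by blast
    qed
  qed
qed

section \<open>Removing and adding a prefix\<close>

definition shift :: "nat \<times> nat \<Rightarrow> nat \<times> nat" where
  "shift p = (fst p + 2, snd p + 2)"

lemma steps_cases:
  "coherent_chain P \<Longrightarrow> e \<in> set (steps P) \<Longrightarrow> e \<in> hsteps P \<or> e \<in> vsteps P"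
proof (induction P rule: steps.induct)
  case (1 p q R)
  then show ?case
    by (auto simp: coherent_chain_Cons estep_def lattice_step_def)
qed auto

text \<open>A step does not record which coordinate changes, hence the two alternatives.\<close>

lemma steps_ge:
  assumes "coherent_chain (p # R)" "(x, y, z) \<in> set (steps (p # R))"
  shows "(fst p \<le> x \<and> snd p \<le> z) \<or> (snd p \<le> x \<and> fst p \<le> z)"
  using steps_cases[OF assms] hstepsD[OF assms(1), of x y z] vstepsD[OF assms(1), of x y z]
    coherent_chain_ge[OF assms(1), of "(x, z)"] coherent_chain_ge[OF assms(1), of "(z, x)"]
  by auto

definition shift_step :: "nat \<times> nat \<times> nat \<Rightarrow> nat \<times> nat \<times> nat" where
  "shift_step = (\<lambda>(i, j, a). (i + 2, j + 2, a + 2))"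

lemma steps_shift: "steps (map shift P) = map shift_step (steps P)"
  by (induction P rule: steps.induct) (auto simp: estep_def shift_def shift_step_def)

lemma coherent_chain_shift [simp]: "coherent_chain (map shift P) = coherent_chain P"
proof -
  have "compatible_steps (shift_step e) (shift_step f) = compatible_steps e f" for e f
    by (cases e; cases f) (auto simp: compatible_steps_def shift_step_def)
  moreover have "lattice_step (shift p) (shift q) = lattice_step p q" for p q
    by (auto simp: lattice_step_def shift_def)
  ultimately show ?thesis
    by (auto simp: coherent_chain_def steps_shift sorted_wrt_map successively_map shift_def)
qed

lemma coherent_chain_swap_iff [simp]: "coherent_chain (map prod.swap P) = coherent_chain P"
  using coherent_chain_swap[of P] coherent_chain_swap[of "map prod.swap P"] by auto

lemma inj_shift: "inj shift"
  by (auto simp: inj_def shift_def prod_eq_iff)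

lemma obtain_shift:
  assumes "coherent_chain (shift p # S)"
  obtains Q where "shift p # S = map shift (p # Q)"
proof
  \<comment> \<open>The subtraction does not truncate: by monotonicity both coordinates are at least
    those of \<open>shift p\<close>.\<close>
  have "shift (fst q - 2, snd q - 2) = q" if "q \<in> set S" for q
    using coherent_chain_ge[OF assms, of q] that by (auto simp: shift_def prod_eq_iff)
  then show "shift p # S = map shift (p # map (\<lambda>q. (fst q - 2, snd q - 2)) S)"
    by (simp add: map_idI)
qed

lemma coherent_chain_append: "coherent_chain (A @ P) \<Longrightarrow> coherent_chain P"
proof (induction A)
  case (Cons p A)
  then have p: "coherent_chain (p # A @ P)"
    by simp
  have "coherent_chain (A @ P)"
  proof (cases "A @ P")
    case Nil
    show ?thesis
      unfolding Nil by (simp add: coherent_chain_def)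
  next
    case (Cons q R)
    show ?thesis
      using p unfolding Cons coherent_chain_Cons by blast
  qed
  then show ?case
    by (rule Cons.IH)
qed simp

text \<open>The point \<open>(4, 3)\<close> is the translate of the prescribed start
  \<open>(2, 1)\<close>, and monotonicity from there keeps all coordinates of \<open>Q\<close>
  positive.\<close>

lemma coherent_path_unshift:
  assumes c: "coherent_chain ((4, 3) # R)" and sub: "set ((4, 3) # R) \<subseteq> {1..n+2} \<times> {1..n+2}"
    and last: "last ((4, 3) # R) \<in> {(n + 1, n + 2), (n + 2, n + 1)}"
  obtains Q where "(4, 3) # R = map shift Q" "coherent_path n Q"
proof -
  have s: "shift (2, 1) = (4, 3)"
    by (simp add: shift_def)
  obtain Q where Q: "(4, 3) # R = map shift ((2, 1) # Q)"
    using obtain_shift[of "(2, 1)" R] c unfolding s by blast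
  have cQ: "coherent_chain ((2, 1) # Q)"
    using c unfolding Q coherent_chain_shift .
  have "q \<in> {1..n} \<times> {1..n}" if "q \<in> set ((2, 1) # Q)" for q
  proof -
    have "shift q \<in> set (map shift ((2, 1) # Q))"
      unfolding set_map using that by (rule imageI)
    then have "shift q \<in> {1..n+2} \<times> {1..n+2}"
      using sub unfolding Q by blast
    then show ?thesis
      using coherent_chain_ge[OF cQ that] by (cases q) (simp add: shift_def)
  qed
  moreover have "shift (last ((2, 1) # Q)) \<in> {(n + 1, n + 2), (n + 2, n + 1)}"
    using last unfolding Q last_map[OF list.distinct(2)] .
  then have "last ((2, 1) # Q) \<in> {(n - 1, n), (n, n - 1)}"
    by (cases "last ((2, 1) # Q)") (auto simp: shift_def)
  ultimately have "coherent_path n ((2, 1) # Q)"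
    using cQ unfolding coherent_path_iff by (metis list.distinct(2) list.sel(1) subsetI)
  then show ?thesis
    using that[of "(2, 1) # Q"] Q by simp
qed

text \<open>End points and range are inherited from \<open>A\<close> and \<open>Q\<close>, where
  \<open>{1..4}\<close> fits into \<open>{1..n + 2}\<close> because \<open>n \<ge> 2\<close>. What
  has to be supplied is the coherence of the joined list.\<close>

lemma coherent_path_prepend:
  assumes Q: "coherent_path n Q" and P: "P = A @ S" "A \<noteq> []" "set A \<subseteq> {1..4} \<times> {1..4}" "hd A = (2, 1)"
    and S: "S = map shift Q \<or> S = map shift (map prod.swap Q)" and n: "n \<ge> 2" and c: "coherent_chain P"
  shows "coherent_path (n + 2) P"
proof -
  have Q': "Q \<noteq> []" "set Q \<subseteq> {1..n} \<times> {1..n}" "last Q \<in> {(n - 1, n), (n, n - 1)}"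
    using Q by (auto simp: coherent_path_iff)
  have "last P = shift (last Q) \<or> last P = shift (prod.swap (last Q))"
    using S Q'(1) P(1) by (auto simp: last_map)
  then have "last P \<in> {(n + 1, n + 2), (n + 2, n + 1)}"
    using Q'(3) n by (auto simp: shift_def)
  moreover have "{1..4} \<subseteq> {1..n + 2}"
    using n by auto
  then have "set A \<subseteq> {1..n + 2} \<times> {1..n + 2}"
    using P(3) by blast
  moreover have "shift p \<in> {1..n + 2} \<times> {1..n + 2} \<and> shift (prod.swap p) \<in> {1..n + 2} \<times> {1..n + 2}"
    if "p \<in> set Q" for p
    using subsetD[OF Q'(2) that] by (cases p) (simp add: shift_def)
  then have "set S \<subseteq> {1..n + 2} \<times> {1..n + 2}"
    using S by fastforce
  ultimately show ?thesis
    using P c by (simp add: coherent_path_iff)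
qed

text \<open>
  When the fourth point is \<open>(3, 4)\<close>, it lies above the diagonal, whence the exchange of coordinates.
\<close>

definition right_turn :: "(nat \<times> nat) list \<Rightarrow> (nat \<times> nat) list" where
  "right_turn Q = [(2, 1), (3, 1), (3, 2)] @ map shift (map prod.swap Q)"

definition right_right :: "(nat \<times> nat) list \<Rightarrow> (nat \<times> nat) list" where
  "right_right Q = [(2, 1), (3, 1), (4, 1)] @ map shift Q"

definition long_right :: "(nat \<times> nat) list \<Rightarrow> (nat \<times> nat) list" where
  "long_right Q = [(2, 1), (4, 1), (4, 2)] @ map shift Q"

definition up_up :: "(nat \<times> nat) list \<Rightarrow> (nat \<times> nat) list" where
  "up_up Q = [(2, 1), (2, 3), (2, 4)] @ map shift (map prod.swap Q)"

section \<open>Coherence of the four extensions\<close>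

lemma steps_Cons: "e \<in> set (steps (p # S)) \<longleftrightarrow> (\<exists>q R. S = q # R \<and> (e = estep p q \<or> e \<in> set (steps S)))"
  by (cases S) auto

text \<open>The translated path starts at \<open>(4, 3)\<close>. If it goes up first, its first step
  has fixed coordinate 4, and afterwards both coordinates are at least 4, so no later step starts at
  3.\<close>

lemma shifted_steps:
  assumes "coherent_chain ((2, 1) # R)" "(x, y, z) \<in> set (steps (map shift ((2, 1) # R)))"
  shows "3 \<le> x"
    and "vertical_start ((2, 1) # R) \<Longrightarrow> x = 3 \<Longrightarrow> z = 4"
proof -
  obtain x' y' z' where *: "x = x' + 2" "z = z' + 2" "(x', y', z') \<in> set (steps ((2, 1) # R))"
    using assms(2) unfolding steps_shift by (auto simp: shift_step_def)
  show "3 \<le> x"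
    using steps_ge[OF assms(1) *(3)] * by auto
  assume v: "vertical_start ((2, 1) # R)" "x = 3"
  obtain q R' where R: "R = q # R'" "(x', y', z') = estep (2, 1) q \<or> (x', y', z') \<in> set (steps R)"
    using *(3) unfolding steps_Cons by auto
  have q: "fst q = 2" "coherent_chain (q # R')" "lattice_step (2, 1) q"
    using v(1)[unfolded vertical_start_def] assms(1) unfolding R
    by (fastforce simp: coherent_chain_Cons)+
  show "z = 4"
    using R(2)
  proof
    assume "(x', y', z') = estep (2, 1) q"
    then show ?thesis
      using q * by (auto simp: estep_def lattice_step_def)
  next
    assume "(x', y', z') \<in> set (steps R)"
    then show ?thesis
      using steps_ge[of q R' x' y' z'] q * v(2) R(1) by (auto simp: lattice_step_def)
  qed
qed

text \<open>Exchanging coordinates does not alter the steps, so one description of them serves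
  suffixes on both sides of the diagonal.\<close>

lemma shifted_chains:
  assumes "coherent_path n Q"
  obtains T U where "map shift Q = (4, 3) # T" "map shift (map prod.swap Q) = (3, 4) # U"
    "coherent_chain ((4, 3) # T)" "coherent_chain ((3, 4) # U)"
    "set (steps ((3, 4) # U)) = set (steps ((4, 3) # T))"
    "\<And>x y z. (x, y, z) \<in> set (steps ((4, 3) # T)) \<Longrightarrow> 3 \<le> x \<and> (vertical_start Q \<longrightarrow> x = 3 \<longrightarrow> z = 4)"
proof -
  obtain R where Q: "Q = (2, 1) # R"
    using assms by (cases Q) (auto simp: coherent_path_iff)
  have c: "coherent_chain Q"
    using assms by (simp add: coherent_path_iff)
  have s: "shift (2, 1) = (4, 3)" "shift (prod.swap (2, 1)) = (3, 4)"
    by (simp_all add: shift_def)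
  show ?thesis
  proof
    show T: "map shift Q = (4, 3) # map shift R"
      and U: "map shift (map prod.swap Q) = (3, 4) # map shift (map prod.swap R)"
      by (simp_all only: Q list.map s)
    show "coherent_chain ((4, 3) # map shift R)" "coherent_chain ((3, 4) # map shift (map prod.swap R))"
      unfolding T[symmetric] U[symmetric] using c by (simp_all del: map_map)
    show "set (steps ((3, 4) # map shift (map prod.swap R))) = set (steps ((4, 3) # map shift R))"
      unfolding T[symmetric] U[symmetric] steps_shift
      using c by (simp add: steps_swap coherent_chain_def del: map_map)
    fix x y z
    assume "(x, y, z) \<in> set (steps ((4, 3) # map shift R))"
    then show "3 \<le> x \<and> (vertical_start Q \<longrightarrow> x = 3 \<longrightarrow> z = 4)"
      using shifted_steps[of R x y z] c unfolding T[symmetric] Q by blast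
  qed
qed

text \<open>Steps of the prefix end at 4 at most and later ones start at 3 or more, so a conflict
  needs \<open>j = 4\<close> and \<open>x = 3\<close>. In \<open>right_turn\<close> the step into 4
  is \<open>(2, 4, 3)\<close>, where \<open>x = a\<close> holds. In the other three it has fixed
  coordinate 1 or 2, so \<open>z = 4\<close> is required; a vertical start provides this.\<close>

lemma coherent_path_prefixes:
  assumes Q: "coherent_path n Q" and n: "n \<ge> 2"
  shows "coherent_path (n + 2) (right_turn Q)"
    and "vertical_start Q \<Longrightarrow> coherent_path (n + 2) (right_right Q)"
    and "vertical_start Q \<Longrightarrow> coherent_path (n + 2) (long_right Q)"
    and "vertical_start Q \<Longrightarrow> coherent_path (n + 2) (up_up Q)"
proof -
  obtain T U where TU: "map shift Q = (4, 3) # T" "map shift (map prod.swap Q) = (3, 4) # U"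
    "coherent_chain ((4, 3) # T)" "coherent_chain ((3, 4) # U)"
    "set (steps ((3, 4) # U)) = set (steps ((4, 3) # T))"
    "\<And>x y z. (x, y, z) \<in> set (steps ((4, 3) # T)) \<Longrightarrow> 3 \<le> x \<and> (vertical_start Q \<longrightarrow> x = 3 \<longrightarrow> z = 4)"
    using shifted_chains[OF Q] by blast
  note defs = right_turn_def right_right_def long_right_def up_up_def
  have "coherent_chain (right_turn Q)"
    unfolding defs TU(2) using TU(4,5,6)
    by (fastforce simp: coherent_chain_Cons lattice_step_def estep_def compatible_steps_def)
  then show "coherent_path (n + 2) (right_turn Q)"
    by (intro coherent_path_prepend[OF Q right_turn_def _ _ _ _ n]) auto
  assume v: "vertical_start Q"
  have "coherent_chain (right_right Q)"
    unfolding defs TU(1) using TU(3,6) v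
    by (fastforce simp: coherent_chain_Cons lattice_step_def estep_def compatible_steps_def)
  then show "coherent_path (n + 2) (right_right Q)"
    by (intro coherent_path_prepend[OF Q right_right_def _ _ _ _ n]) auto
  have "coherent_chain (long_right Q)"
    unfolding defs TU(1) using TU(3,6) v
    by (fastforce simp: coherent_chain_Cons lattice_step_def estep_def compatible_steps_def)
  then show "coherent_path (n + 2) (long_right Q)"
    by (intro coherent_path_prepend[OF Q long_right_def _ _ _ _ n]) auto
  have "coherent_chain (up_up Q)"
    unfolding defs TU(2) using TU(4,5,6) v
    by (fastforce simp: coherent_chain_Cons lattice_step_def estep_def compatible_steps_def)
  then show "coherent_path (n + 2) (up_up Q)"
    by (intro coherent_path_prepend[OF Q up_up_def _ _ _ _ n]) auto
qed

section \<open>Recovering the shorter path from a suffix\<close>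

lemma vertical_start_shift: "vertical_start (map shift P) = vertical_start P"
  by (auto simp: vertical_start_def map_eq_Cons_conv shift_def)

lemma coherent_path_suffix:
  assumes "coherent_path (n + 2) (A @ (4, 3) # R)"
  obtains Q where "(4, 3) # R = map shift Q" "coherent_path n Q"
proof -
  have "coherent_chain ((4, 3) # R)"
    using assms coherent_chain_append unfolding coherent_path_iff by blast
  moreover have "set ((4, 3) # R) \<subseteq> {1..n+2} \<times> {1..n+2}"
    using assms unfolding coherent_path_iff by (simp del: One_nat_def)
  moreover have "last ((4, 3) # R) \<in> {(n + 1, n + 2), (n + 2, n + 1)}"
    using assms unfolding coherent_path_iff by (simp del: last.simps)
  ultimately show ?thesis
    using coherent_path_unshift that by blast
qed

lemma coherent_path_suffix_swap:
  assumes "coherent_path (n + 2) (A @ (3, 4) # R)"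
  obtains Q where "(3, 4) # R = map shift (map prod.swap Q)" "coherent_path n Q"
proof -
  let ?R = "map prod.swap R"
  have R: "(4, 3) # ?R = map prod.swap ((3, 4) # R)"
    by simp
  have "coherent_chain ((3, 4) # R)"
    using assms coherent_chain_append unfolding coherent_path_iff by blast
  then have "coherent_chain ((4, 3) # ?R)"
    unfolding R coherent_chain_swap_iff .
  moreover have "set ((3, 4) # R) \<subseteq> {1..n+2} \<times> {1..n+2}"
    using assms unfolding coherent_path_iff by (simp del: One_nat_def)
  then have "set ((4, 3) # ?R) \<subseteq> {1..n+2} \<times> {1..n+2}"
    unfolding R by fastforce
  moreover have "last ((3, 4) # R) \<in> {(n + 1, n + 2), (n + 2, n + 1)}"
    using assms unfolding coherent_path_iff by (simp del: last.simps)
  then have "last ((4, 3) # ?R) \<in> {(n + 1, n + 2), (n + 2, n + 1)}"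
    unfolding R last_map[OF list.distinct(2)] by (auto simp del: last.simps)
  ultimately obtain Q where Q: "(4, 3) # ?R = map shift Q" "coherent_path n Q"
    using coherent_path_unshift by blast
  have "(3, 4) # R = map prod.swap (map shift Q)"
    unfolding Q(1)[symmetric] by (simp add: map_idI)
  then show ?thesis
    using that Q(2) by (simp add: shift_def o_def)
qed

section \<open>Counting\<close>

text \<open>The length is set to the bound instead of \<open>max_length n\<close>, which lets the
  recursion start from sizes 2 and 3.\<close>

definition max_paths :: "nat \<Rightarrow> (nat \<times> nat) list set" where
  "max_paths n = {P. coherent_path n P \<and> length P = 3 * (n - 1) div 2}"

definition vertical_max_paths :: "nat \<Rightarrow> (nat \<times> nat) list set" where
  "vertical_max_paths n = {P \<in> max_paths n. vertical_start P}"

text \<open>Raising the size by 2 raises the bound by 3, the number of points put in front. So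
  longest paths go to longest paths in both directions, by \<open>max_path_prefix\<close> and
  \<open>coherent_path_prefixes\<close>.\<close>

lemma max_paths_add_2:
  assumes n: "n \<ge> 2"
  shows "max_paths (n + 2) = right_turn ` max_paths n \<union> right_right ` vertical_max_paths n \<union>
    long_right ` vertical_max_paths n \<union> up_up ` vertical_max_paths n"
proof -
  have len: "3 * (n + 2 - 1) div 2 = 3 + 3 * (n - 1) div 2"
    using n by presburger
  note defs = right_turn_def right_right_def long_right_def up_up_def
  show ?thesis
  proof (intro equalityI subsetI)
    fix P assume "P \<in> max_paths (n + 2)"
    then have P: "coherent_path (n + 2) P" and l: "length P = 3 * (n + 2 - 1) div 2"
      by (auto simp: max_paths_def)
    have n4: "n + 2 \<ge> 4"
      using n by simp
    from P n4 l show "P \<in> right_turn ` max_paths n \<union> right_right ` vertical_max_paths n \<union>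
        long_right ` vertical_max_paths n \<union> up_up ` vertical_max_paths n"
    proof (cases rule: max_path_prefix)
      case (right_turn R)
      then have R: "P = [(2, 1), (3, 1), (3, 2)] @ (3, 4) # R"
        by simp
      obtain Q where Q: "(3, 4) # R = map shift (map prod.swap Q)" "coherent_path n Q"
        using P unfolding R by (rule coherent_path_suffix_swap)
      have "P = right_turn Q"
        unfolding R Q(1) defs ..
      moreover have "Q \<in> max_paths n"
        using Q(2) l len unfolding calculation by (simp add: max_paths_def defs)
      ultimately show ?thesis by blast
    next
      case (right_right R)
      then have R: "P = [(2, 1), (3, 1), (4, 1)] @ (4, 3) # R"
        by simp
      obtain Q where Q: "(4, 3) # R = map shift Q" "coherent_path n Q"
        using P unfolding R by (rule coherent_path_suffix)
      have "P = right_right Q"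
        unfolding R Q(1) defs ..
      moreover have "Q \<in> vertical_max_paths n"
        using Q(2) l len right_right(2) unfolding calculation Q(1) vertical_start_shift
        by (simp add: vertical_max_paths_def max_paths_def defs)
      ultimately show ?thesis by blast
    next
      case (long_right R)
      then have R: "P = [(2, 1), (4, 1), (4, 2)] @ (4, 3) # R"
        by simp
      obtain Q where Q: "(4, 3) # R = map shift Q" "coherent_path n Q"
        using P unfolding R by (rule coherent_path_suffix)
      have "P = long_right Q"
        unfolding R Q(1) defs ..
      moreover have "Q \<in> vertical_max_paths n"
        using Q(2) l len long_right(2) unfolding calculation Q(1) vertical_start_shift
        by (simp add: vertical_max_paths_def max_paths_def defs)
      ultimately show ?thesis by blast
    next
      case (up_up R)
      then have R: "P = [(2, 1), (2, 3), (2, 4)] @ (3, 4) # R"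
        by simp
      obtain Q where Q: "(3, 4) # R = map shift (map prod.swap Q)" "coherent_path n Q"
        using P unfolding R by (rule coherent_path_suffix_swap)
      have "P = up_up Q"
        unfolding R Q(1) defs ..
      moreover have "map prod.swap (map shift (map prod.swap Q)) = map shift Q"
        by (simp add: shift_def o_def)
      then have "vertical_start Q"
        using up_up(2) unfolding Q(1) by (simp only: vertical_start_shift)
      then have "Q \<in> vertical_max_paths n"
        using Q(2) l len unfolding calculation
        by (simp add: vertical_max_paths_def max_paths_def defs)
      ultimately show ?thesis by blast
    qed
  next
    have l: "length (right_turn Q) = 3 + length Q" "length (right_right Q) = 3 + length Q"
      "length (long_right Q) = 3 + length Q" "length (up_up Q) = 3 + length Q" for Q
      by (simp_all add: defs)
    fix P
    assume "P \<in> right_turn ` max_paths n \<union> right_right ` vertical_max_paths n \<union>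
        long_right ` vertical_max_paths n \<union> up_up ` vertical_max_paths n"
    then show "P \<in> max_paths (n + 2)"
      using coherent_path_prefixes[OF _ n] unfolding max_paths_def vertical_max_paths_def len
      by (auto simp only: l)
  qed
qed

text \<open>Only the prefix of \<open>up_up\<close> begins with a vertical step.\<close>

lemma vertical_max_paths_add_2:
  assumes "n \<ge> 2"
  shows "vertical_max_paths (n + 2) = up_up ` vertical_max_paths n"
proof -
  have "vertical_start (up_up Q)" "\<not> vertical_start (right_turn Q)"
    "\<not> vertical_start (right_right Q)" "\<not> vertical_start (long_right Q)" for Q
    by (simp_all add: vertical_start_def right_turn_def right_right_def long_right_def up_up_def)
  then show ?thesis
    unfolding vertical_max_paths_def max_paths_add_2[OF assms] by blast
qed

lemma max_paths_2: "max_paths 2 = {[(2, 1)]}"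
proof -
  have "coherent_path 2 [(2, 1)]"
    by (simp add: coherent_path_iff coherent_chain_def)
  then show ?thesis
    by (auto simp: max_paths_def length_Suc_conv coherent_path_iff)
qed

lemma max_paths_3: "max_paths 3 = {[(2, 1), (3, 1), (3, 2)]}"
proof (intro equalityI subsetI)
  fix P assume "P \<in> max_paths 3"
  then have "coherent_path 3 P" "length P = 3"
    by (auto simp: max_paths_def)
  then obtain p q where "P = [(2, 1), p, q]"
    by (cases P) (auto simp: length_Suc_conv eval_nat_numeral coherent_path_iff)
  with \<open>coherent_path 3 P\<close> show "P \<in> {[(2, 1), (3, 1), (3, 2)]}"
    by (cases p; cases q) (auto simp: coherent_path_iff coherent_chain_Cons coherent_chain_def lattice_step_def)
next
  fix P :: "(nat \<times> nat) list"
  assume "P \<in> {[(2, 1), (3, 1), (3, 2)]}"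
  then show "P \<in> max_paths 3"
    by (simp add: max_paths_def coherent_path_iff coherent_chain_def lattice_step_def compatible_steps_def estep_def)
qed

lemma finite_max_paths: "finite (max_paths n)"
  using finite_coherent_paths[of n] unfolding max_paths_def by (rule rev_finite_subset) auto

text \<open>The four extensions are injective, and their images are disjoint because the prefixes
  differ.\<close>

lemma card_max_paths_add_2:
  assumes n: "n \<ge> 2"
  shows "card (max_paths (n + 2)) = card (max_paths n) + 3 * card (vertical_max_paths n)"
    and "card (vertical_max_paths (n + 2)) = card (vertical_max_paths n)"
proof -
  note defs = right_turn_def right_right_def long_right_def up_up_def
  have inj: "inj right_turn" "inj right_right" "inj long_right" "inj up_up"
    unfolding defs using inj_shift by (auto simp: inj_def simp del: map_map dest: map_injective)
  have fin: "finite (max_paths n)" "finite (vertical_max_paths n)"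
    using finite_max_paths[of n] by (simp_all add: vertical_max_paths_def)
  have card: "card (right_turn ` A) = card A" "card (right_right ` A) = card A"
    "card (long_right ` A) = card A" "card (up_up ` A) = card A" for A
    by (rule card_image, rule inj_on_subset[OF _ subset_UNIV], rule inj)+
  show "card (vertical_max_paths (n + 2)) = card (vertical_max_paths n)"
    unfolding vertical_max_paths_add_2[OF n] card ..
  have "right_turn Q \<noteq> right_right Q'" "right_turn Q \<noteq> long_right Q'" "right_turn Q \<noteq> up_up Q'"
    "right_right Q \<noteq> long_right Q'" "right_right Q \<noteq> up_up Q'" "long_right Q \<noteq> up_up Q'" for Q Q'
    by (simp_all add: defs)
  then have disjoint: "right_turn ` A \<inter> right_right ` B = {}"
      "(right_turn ` A \<union> right_right ` B) \<inter> long_right ` B = {}"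
      "(right_turn ` A \<union> right_right ` B \<union> long_right ` B) \<inter> up_up ` B = {}" for A B
    by blast+
  show "card (max_paths (n + 2)) = card (max_paths n) + 3 * card (vertical_max_paths n)"
    unfolding max_paths_add_2[OF n]
    by (subst card_Un_disjoint, (intro finite_UnI finite_imageI fin disjoint)+)+ (simp add: card)
qed

text \<open>The one-point path of size 2 counts as vertical. It has one vertical descendant in each
  even size, so every increase of the size by 2 adds 3 paths.\<close>

lemma card_max_paths_even:
  "card (max_paths (2 * m + 2)) = 3 * m + 1 \<and> card (vertical_max_paths (2 * m + 2)) = 1"
proof (induction m)
  case 0
  have "vertical_max_paths 2 = {[(2, 1)]}"
    by (auto simp: vertical_max_paths_def max_paths_2 vertical_start_def)
  then show ?case
    unfolding mult_0_right add_0 by (simp add: max_paths_2)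
next
  case (Suc m)
  then show ?case
    using card_max_paths_add_2[of "2 * m + 2"] by simp
qed

text \<open>The only longest path of size 3 starts horizontally, so no vertical ones ever arise and
  the count stays 1.\<close>

lemma card_max_paths_odd:
  "card (max_paths (2 * m + 3)) = 1 \<and> card (vertical_max_paths (2 * m + 3)) = 0"
proof (induction m)
  case 0
  have "vertical_max_paths 3 = {}"
    by (auto simp: vertical_max_paths_def max_paths_3 vertical_start_def)
  then show ?case
    by (simp add: max_paths_3)
next
  case (Suc m)
  then show ?case
    using card_max_paths_add_2[of "2 * m + 3"] by simp
qed

theorem theorem5p6:
  fixes n :: nat
  assumes "n \<ge> 4"
  shows "int (max_length n) = \<lfloor>3 / 2 * (real n - 1)\<rfloor> \<and>
    int (card {P. coherent_path n P \<and> length P = max_length n}) =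
      (if odd n then 1 else \<lfloor>3 / 2 * (real n - 1)\<rfloor>)"
proof -
  have card: "card (max_paths n) = (if odd n then 1 else 3 * (n - 1) div 2)"
  proof (cases "odd n")
    case True
    then obtain m where "n = 2 * m + 3"
      using assms by (intro that[of "(n - 3) div 2"]) presburger
    then show ?thesis
      using card_max_paths_odd[of m] by simp
  next
    case False
    then obtain m where "n = 2 * m + 2"
      using assms by (intro that[of "(n - 2) div 2"]) presburger
    moreover have "3 * (2 * m + 2 - 1) div 2 = 3 * m + 1"
      by simp
    ultimately show ?thesis
      using card_max_paths_even[of m] by simp
  qed
  \<comment> \<open>The count is positive, so the bound is attained and equals
    \<open>max_length n\<close>.\<close>
  then have "max_paths n \<noteq> {}"
    using assms by (auto split: if_splits)
  then obtain P where P: "coherent_path n P" "length P = 3 * (n - 1) div 2"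
    unfolding max_paths_def by blast
  have "max_length n = 3 * (n - 1) div 2"
    unfolding max_length_def
  proof (rule Max_eqI)
    show "finite (length ` {P. coherent_path n P})"
      using finite_coherent_paths by (rule finite_imageI)
    show "3 * (n - 1) div 2 \<in> length ` {P. coherent_path n P}"
      using P by force
    show "l \<le> 3 * (n - 1) div 2" if "l \<in> length ` {P. coherent_path n P}" for l
      using that coherent_path_length(1)[of n] assms by auto
  qed
  moreover have "\<lfloor>3 / 2 * (real n - 1)\<rfloor> = int (3 * (n - 1) div 2)"
    using assms floor_divide_of_nat_eq[of "3 * (n - 1)" 2, where ?'a = real] by (simp add: of_nat_diff)
  ultimately show ?thesis
    using card by (simp add: max_paths_def)
qed

end
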